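(* Let $\lambda=(m,n)$ be a triangular $2$-partition and let $\theta$ be a row-regular tableau on $\lambda$. Then $$A_\theta(q,t)=\sum_{0\le d\le \min(n,\,m-n)} s_{(m+n-2d,\,d)}(q,t).$$
   Context: A partition $\lambda=(\lambda_1\ge\lambda_2\ge\cdots)$ is drawn in French convention: cell $(\ell,c)$ (row $\ell\ge0$ counted from the bottom, column $c\ge 0$) belongs to $\lambda$ iff $c<\lambda_{\ell+1}$. A $2$-partition $(m,n)$ has $m\ge n\ge 0$: a bottom row of $m$ cells and an upper row of $n$ cells. A partition $\lambda$ is triangular if there are positive reals $r,s$ with $\lambda_j=\lfloor r-jr/s\rfloor$ for integers $1\le j\le s$ and $\lambda_j=0$ for $j>s$. A subpartition $\mu\subseteq\lambda$ satisfies $\mu_i\le\lambda_i$ for all $i$; its area is $\mathrm{area}(\lambda,\mu)=|\lambda|-|\mu|$. A standard Young tableau $\theta$ of shape $\lambda$ is a bijection from the cells of $\lambda$ to $\{1,\dots,|\lambda|\}$ increasing to the right along rows and upwards along columns. Given a subpartition $\mu$, a cell $d$ is a $\theta$-deficit cell of $(\lambda,\mu)$ if there exist cells $c_1=(i_1,j_1)\in\mu$ and $c_2=(i_2,j_2)\in\lambda\setminus\mu$ with $\theta(c_1)>\theta(c_2)$ and $d=(\min(i_1,i_2),\min(j_1,j_2))$. Let $\mathrm{sim}_\theta(\mu)$ be the number of cells of $\mu$ which are not $\theta$-deficit cells, and $A_\theta(q,t)=\sum_{\mu\subseteq\lambda}q^{\mathrm{area}(\lambda,\mu)}t^{\mathrm{sim}_\theta(\mu)}$,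 summed over all subpartitions $\mu$ of $\lambda$. For a triangular $2$-partition $\lambda=(m,n)$ and an integer $i$ with $1\le i\le m-2(n-1)$, the $i$-row-regular tableau of $\lambda$ is the standard Young tableau whose upper row has labels $n+i,n+i+2,\dots,n+i+2(n-1)$ (the bottom row then contains the remaining labels in increasing order); a row-regular tableau is an $i$-row-regular tableau for some such $i$. For integers $b\ge a\ge0$, $s_{(b,a)}(q,t)=\sum_{k=a}^{b}q^k t^{a+b-k}$ is the Schur polynomial in two variables. *)

theory Defs
  imports Complex_Main "HOL-Computational_Algebra.Polynomial"
begin

text \<open>
  A partition is represented by its row-length function, with rows numbered from \<open>0\<close>
  (the bottom row, in French convention): \<open>lam l\<close> is the part usually written
  \<open>\<lambda>\<^sub>l\<^sub>+\<^sub>1\<close>.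
\<close>

definition is_partition :: "(nat \<Rightarrow> nat) \<Rightarrow> bool" where
  "is_partition lam \<longleftrightarrow> antimono lam \<and> finite {l. lam l \<noteq> 0}"

definition cells :: "(nat \<Rightarrow> nat) \<Rightarrow> (nat \<times> nat) set" where
  "cells lam = {(l, c). c < lam l}"

definition two_partition :: "nat \<Rightarrow> nat \<Rightarrow> nat \<Rightarrow> nat" where
  "two_partition m n = (\<lambda>l. if l = 0 then m else if l = 1 then n else 0)"

definition triangular :: "(nat \<Rightarrow> nat) \<Rightarrow> bool" where
  "triangular lam \<longleftrightarrow> is_partition lam \<and>
     (\<exists>r s :: real. r > 0 \<and> s > 0 \<and>
        (\<forall>j\<ge>1. (real j \<le> s \<longrightarrow> int (lam (j - 1)) = \<lfloor>r - real j * r / s\<rfloor>) \<and>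
               (real j > s \<longrightarrow> lam (j - 1) = 0)))"

definition subpartitions :: "(nat \<Rightarrow> nat) \<Rightarrow> (nat \<Rightarrow> nat) set" where
  "subpartitions lam = {mu. is_partition mu \<and> (\<forall>l. mu l \<le> lam l)}"

definition area :: "(nat \<Rightarrow> nat) \<Rightarrow> (nat \<Rightarrow> nat) \<Rightarrow> nat" where
  "area lam mu = card (cells lam) - card (cells mu)"

text \<open>Only the values of \<open>\<theta>\<close> on the cells of \<open>lam\<close> are relevant.\<close>

definition standard_tableau :: "(nat \<Rightarrow> nat) \<Rightarrow> (nat \<times> nat \<Rightarrow> nat) \<Rightarrow> bool" where
  "standard_tableau lam \<theta> \<longleftrightarrow>
     bij_betw \<theta> (cells lam) {1..card (cells lam)} \<and>
     (\<forall>l c c'. (l, c) \<in> cells lam \<and> (l, c') \<in> cells lam \<and> c < c' \<longrightarrow> \<theta> (l, c) < \<theta> (l, c')) \<and>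
     (\<forall>l l' c. (l, c) \<in> cells lam \<and> (l', c) \<in> cells lam \<and> l < l' \<longrightarrow> \<theta> (l, c) < \<theta> (l', c))"

definition deficit_cells ::
  "(nat \<Rightarrow> nat) \<Rightarrow> (nat \<times> nat \<Rightarrow> nat) \<Rightarrow> (nat \<Rightarrow> nat) \<Rightarrow> (nat \<times> nat) set" where
  "deficit_cells lam \<theta> mu =
     {d. \<exists>i1 j1 i2 j2. (i1, j1) \<in> cells mu \<and> (i2, j2) \<in> cells lam - cells mu \<and>
           \<theta> (i1, j1) > \<theta> (i2, j2) \<and> d = (min i1 i2, min j1 j2)}"

definition sim :: "(nat \<Rightarrow> nat) \<Rightarrow> (nat \<times> nat \<Rightarrow> nat) \<Rightarrow> (nat \<Rightarrow> nat) \<Rightarrow> nat" where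
  "sim lam \<theta> mu = card (cells mu - deficit_cells lam \<theta> mu)"

text \<open>
  Polynomials in \<open>q\<close> and \<open>t\<close> are elements of \<open>\<int>[q][t]\<close>: the variable \<open>q\<close> lives in the
  coefficient ring and \<open>t\<close> is the outer variable.
\<close>

definition q_var :: "int poly poly" where
  "q_var = [:[:0, 1:]:]"

definition t_var :: "int poly poly" where
  "t_var = [:0, 1:]"

definition A_poly :: "(nat \<Rightarrow> nat) \<Rightarrow> (nat \<times> nat \<Rightarrow> nat) \<Rightarrow> int poly poly" where
  "A_poly lam \<theta> =
     (\<Sum>mu\<in>subpartitions lam. q_var ^ area lam mu * t_var ^ sim lam \<theta> mu)"

definition schur2 :: "nat \<Rightarrow> nat \<Rightarrow> int poly poly" where
  "schur2 b a = (\<Sum>k=a..b. q_var ^ k * t_var ^ (a + b - k))"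

definition i_row_regular :: "nat \<Rightarrow> nat \<Rightarrow> nat \<Rightarrow> (nat \<times> nat \<Rightarrow> nat) \<Rightarrow> bool" where
  "i_row_regular m n i \<theta> \<longleftrightarrow>
     standard_tableau (two_partition m n) \<theta> \<and> (\<forall>j<n. \<theta> (1, j) = n + i + 2 * j)"

text \<open>The bound on \<open>i\<close> is an inequality of integers, so that \<open>n = 0\<close> causes no truncation.\<close>

definition row_regular :: "nat \<Rightarrow> nat \<Rightarrow> (nat \<times> nat \<Rightarrow> nat) \<Rightarrow> bool" where
  "row_regular m n \<theta> \<longleftrightarrow>
     (\<exists>i. 1 \<le> i \<and> int i \<le> int m - 2 * (int n - 1) \<and> i_row_regular m n i \<theta>)"

end

theory Submission
  imports Defs
begin

text \<open>
  Put \<open>k = n + i - 1\<close>. Counting the labels below \<open>\<theta> (1, j)\<close> shows that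
  \<open>\<theta> (0, c) < \<theta> (1, j)\<close> iff \<open>c < k + j\<close>, so the deficit cells of \<open>(a, b)\<close> lie in the
  bottom row and occupy the columns \<open>b \<le> j < min n (a - k)\<close> and \<open>a - k < j < b\<close>.
  Let \<open>D\<close> be their number. The theorem then says that \<open>(a, b) \<mapsto> (a + b, D)\<close> is a bijection
  from the subpartitions onto the pairs \<open>(s, d)\<close> with \<open>d \<le> min n (m - n)\<close> and
  \<open>2 d \<le> s \<le> m + n - d\<close>: for fixed \<open>s\<close> and with \<open>u = s - k\<close>, the number \<open>D\<close> is one of
  \<open>n - b\<close>, \<open>u - 2 b\<close>, \<open>2 b - u - 1\<close>, \<open>b\<close> as \<open>b\<close> increases, where the two middle
  expressions have opposite parities and fill the values left free by the outer ones.
\<close>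

section \<open>Subpartitions of a two-row shape as pairs of row lengths\<close>

lemma is_partition_two_partition_iff: "is_partition (two_partition a b) \<longleftrightarrow> b \<le> a"
proof
  assume "is_partition (two_partition a b)"
  then have "two_partition a b 1 \<le> two_partition a b 0"
    by (simp add: is_partition_def antimonoD)
  then show "b \<le> a" by (simp add: two_partition_def)
next
  assume "b \<le> a"
  then have "antimono (two_partition a b)"
    by (auto simp: antimono_def two_partition_def)
  moreover have "{l. two_partition a b l \<noteq> 0} \<subseteq> {0, 1}"
    by (auto simp: two_partition_def)
  ultimately show "is_partition (two_partition a b)"
    unfolding is_partition_def using finite_subset by blast
qed

lemma subpartitions_two_partition:
  "subpartitions (two_partition m n) =
     (\<lambda>(a, b). two_partition a b) ` {(a, b). b \<le> a \<and> a \<le> m \<and> b \<le> n}"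
proof (intro equalityI subsetI)
  fix mu assume mu: "mu \<in> subpartitions (two_partition m n)"
  then have le: "mu l \<le> two_partition m n l" for l
    by (simp add: subpartitions_def)
  have eq: "mu = two_partition (mu 0) (mu 1)"
  proof
    fix l show "mu l = two_partition (mu 0) (mu 1) l"
      using le[of l] by (auto simp: two_partition_def)
  qed
  with mu have "is_partition (two_partition (mu 0) (mu 1))"
    by (simp add: subpartitions_def)
  then have "mu 1 \<le> mu 0" by (simp only: is_partition_two_partition_iff)
  moreover have "mu 0 \<le> m" "mu 1 \<le> n"
    using le[of 0] le[of 1] by (auto simp: two_partition_def)
  ultimately show "mu \<in> (\<lambda>(a, b). two_partition a b) ` {(a, b). b \<le> a \<and> a \<le> m \<and> b \<le> n}"
    using eq by (intro image_eqI[where x = "(mu 0, mu 1)"]) auto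
next
  fix mu assume "mu \<in> (\<lambda>(a, b). two_partition a b) ` {(a, b). b \<le> a \<and> a \<le> m \<and> b \<le> n}"
  then obtain a b where "mu = two_partition a b" "b \<le> a" "a \<le> m" "b \<le> n" by auto
  then show "mu \<in> subpartitions (two_partition m n)"
    by (auto simp: subpartitions_def is_partition_two_partition_iff)
       (auto simp: two_partition_def)
qed

lemma inj_two_partition: "inj (\<lambda>(a, b). two_partition a b)"
proof (rule injI, clarify)
  fix a b a' b' assume "two_partition a b = two_partition a' b'"
  then have "two_partition a b l = two_partition a' b' l" for l by simp
  from this[of 0] this[of 1] show "a = a' \<and> b = b'"
    by (auto simp: two_partition_def)
qed

lemma mem_cells_two_partition:
  "(l, c) \<in> cells (two_partition a b) \<longleftrightarrow> l = 0 \<and> c < a \<or> l = 1 \<and> c < b"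
  by (auto simp: cells_def two_partition_def)

lemma cells_two_partition: "cells (two_partition a b) = Pair 0 ` {..<a} \<union> Pair 1 ` {..<b}"
  by (auto simp: mem_cells_two_partition)

lemma card_cells_two_partition: "card (cells (two_partition a b)) = a + b"
proof -
  have "card (Pair (0::nat) ` {..<a} \<union> Pair 1 ` {..<b}) =
      card (Pair (0::nat) ` {..<a}) + card (Pair (1::nat) ` {..<b})"
    by (rule card_Un_disjoint) auto
  then show ?thesis by (simp add: cells_two_partition card_image inj_on_def)
qed

section \<open>Comparison of labels between the two rows\<close>

lemma card_standard_tableau_less:
  assumes "standard_tableau lam \<theta>" "x \<in> cells lam"
  shows "card {y \<in> cells lam. \<theta> y < \<theta> x} = \<theta> x - 1"
proof -
  have bij: "bij_betw \<theta> (cells lam) {1..card (cells lam)}"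
    using assms(1) by (simp add: standard_tableau_def)
  then have x: "\<theta> x \<in> {1..card (cells lam)}"
    using assms(2) bij_betwE by blast
  have "\<theta> ` {y \<in> cells lam. \<theta> y < \<theta> x} = {y \<in> \<theta> ` cells lam. y < \<theta> x}"
    by auto
  also have "\<dots> = {1..<\<theta> x}"
    using bij x unfolding bij_betw_def by auto
  finally have "\<theta> ` {y \<in> cells lam. \<theta> y < \<theta> x} = {1..<\<theta> x}" .
  moreover have "inj_on \<theta> {y \<in> cells lam. \<theta> y < \<theta> x}"
    using bij by (auto simp: bij_betw_def inj_on_def)
  ultimately show ?thesis using card_image by fastforce
qed

lemma down_closed_nat_eq_lessThan:
  fixes S :: "nat set"
  assumes "finite S" "\<And>x y. x \<in> S \<Longrightarrow> y < x \<Longrightarrow> y \<in> S"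
  shows "S = {..<card S}"
proof -
  have "S \<subseteq> {..<card S}"
  proof
    fix x assume "x \<in> S"
    then have "{..x} \<subseteq> S" using assms(2) by (auto simp: le_less)
    then have "card {..x} \<le> card S" using assms(1) card_mono by blast
    then show "x \<in> {..<card S}" by simp
  qed
  then show ?thesis by (intro card_subset_eq) auto
qed

text \<open>Of the \<open>n + i + 2 * j - 1\<close> labels below \<open>\<theta> (1, j)\<close>,
  exactly \<open>j\<close> lie in the upper row. The other \<open>n + i + j - 1\<close> lie in the
  bottom row and, as that row increases, fill its first columns.\<close>

lemma row_regular_less_iff:
  assumes reg: "i_row_regular m n i \<theta>" and "j < n" "c < m"
  shows "\<theta> (0, c) < \<theta> (1, j) \<longleftrightarrow> c < n + i + j - 1"
proof -
  let ?lam = "two_partition m n"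
  let ?S = "{c. c < m \<and> \<theta> (0, c) < \<theta> (1, j)}"
  have st: "standard_tableau ?lam \<theta>" and up: "\<And>j. j < n \<Longrightarrow> \<theta> (1, j) = n + i + 2 * j"
    using reg by (auto simp: i_row_regular_def)
  have mono: "\<theta> (0, c) < \<theta> (0, c')" if "c < c'" "c' < m" for c c'
    using st that by (auto simp: standard_tableau_def mem_cells_two_partition)
  have "{y \<in> cells ?lam. \<theta> y < \<theta> (1, j)} = Pair 0 ` ?S \<union> Pair 1 ` {..<j}"
    using \<open>j < n\<close> up by (auto simp: cells_two_partition)
  moreover have "card (Pair (0::nat) ` ?S \<union> Pair 1 ` {..<j}) =
      card (Pair (0::nat) ` ?S) + card (Pair (1::nat) ` {..<j})"
    by (rule card_Un_disjoint) auto
  moreover have "\<dots> = card ?S + j" by (simp add: card_image inj_on_def)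
  moreover have "card {y \<in> cells ?lam. \<theta> y < \<theta> (1, j)} = \<theta> (1, j) - 1"
    using card_standard_tableau_less[OF st] \<open>j < n\<close> by (simp add: mem_cells_two_partition)
  ultimately have "card ?S + j = n + i + 2 * j - 1" using up[OF \<open>j < n\<close>] by simp
  then have card: "card ?S = n + i + j - 1" using \<open>j < n\<close> by simp
  have "?S = {..<card ?S}"
    by (rule down_closed_nat_eq_lessThan) (auto dest: mono intro: less_trans)
  then have "c \<in> ?S \<longleftrightarrow> c < n + i + j - 1" using card by auto
  with \<open>c < m\<close> show ?thesis by simp
qed

section \<open>Deficit cells of a row-regular tableau\<close>

text \<open>Truncated subtraction is intended: both column ranges start at column \<open>0\<close> at the earliest.\<close>

definition deficit :: "nat \<Rightarrow> nat \<Rightarrow> nat \<Rightarrow> nat \<Rightarrow> nat" where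
  "deficit n k a b = (min n (a - k) - b) + (b - (a + 1 - k))"

text \<open>Within a row the cells of the subpartition precede the others, so every inversion joins
  the two rows. Each direction of inversion yields one of the two column ranges.\<close>

lemma deficit_cells_row_regular:
  assumes reg: "i_row_regular m n i \<theta>" and i: "1 \<le> i"
    and k: "k = n + i - 1" "k + n \<le> m + 1"
    and ab: "b \<le> a" "a \<le> m" "b \<le> n"
  shows "deficit_cells (two_partition m n) \<theta> (two_partition a b) =
           Pair 0 ` ({b..<min n (a - k)} \<union> {a + 1 - k..<b})"
    (is "?L = ?R")
proof -
  let ?lam = "two_partition m n" and ?mu = "two_partition a b"
  have st: "standard_tableau ?lam \<theta>"
    using reg by (simp add: i_row_regular_def)
  have inj: "inj_on \<theta> (cells ?lam)"
    using st by (auto simp: standard_tableau_def bij_betw_def)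
  have row: "\<theta> (l, c) < \<theta> (l, c')" if "(l, c) \<in> cells ?lam" "(l, c') \<in> cells ?lam" "c < c'" for l c c'
    using st that unfolding standard_tableau_def by blast
  have lt: "\<theta> (0, c) < \<theta> (1, j) \<longleftrightarrow> c < k + j" if "j < n" "c < m" for c j
    using row_regular_less_iff[OF reg that] i k(1) by simp
  have gt: "\<theta> (1, j) < \<theta> (0, c) \<longleftrightarrow> k + j \<le> c" if "j < n" "c < m" for c j
  proof -
    have "\<theta> (1, j) \<noteq> \<theta> (0, c)"
      using inj_onD[OF inj, of "(1, j)" "(0, c)"] that by (auto simp: mem_cells_two_partition)
    then show ?thesis using lt[OF that] by linarith
  qed
  have "x \<in> ?R" if x: "x \<in> ?L" for x
  proof -
    obtain i1 j1 i2 j2 where c1: "(i1, j1) \<in> cells ?mu" and c2: "(i2, j2) \<in> cells ?lam - cells ?mu"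
      and th: "\<theta> (i1, j1) > \<theta> (i2, j2)" and d: "x = (min i1 i2, min j1 j2)"
      using x unfolding deficit_cells_def by blast
    have c1': "(i1, j1) \<in> cells ?lam" using c1 ab by (auto simp: mem_cells_two_partition)
    have "i1 \<noteq> i2"
    proof
      assume eq: "i1 = i2"
      then have "j1 < j2" using c1 c2 by (auto simp: mem_cells_two_partition)
      then show False using row[of i1 j1 j2] c1' c2 th eq by auto
    qed
    then consider "i1 = 0" "i2 = 1" | "i1 = 1" "i2 = 0"
      using c1 c2 by (auto simp: mem_cells_two_partition)
    \<comment> \<open>In both cases the deficit cell lies directly below the upper cell:
      \<open>k + j2 \<le> j1\<close> in the first, \<open>j1 < b \<le> a \<le> j2\<close> in the
      second.\<close>
    then show ?thesis
    proof cases
      case 1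
      then have "j1 < a" "b \<le> j2" "j2 < n" "k + j2 \<le> j1"
        using c1 c2 th gt[of j2 j1] ab by (auto simp: mem_cells_two_partition)
      then show ?thesis using d 1 by auto
    next
      case 2
      then have "j1 < b" "a \<le> j2" "j2 < m" "j2 < k + j1"
        using c1 c2 th lt[of j1 j2] ab by (auto simp: mem_cells_two_partition)
      then show ?thesis using d 2 ab by auto
    qed
  qed
  moreover have "x \<in> ?L" if x: "x \<in> ?R" for x
  proof -
    obtain j where xj: "x = (0, j)" and j: "b \<le> j \<and> j < n \<and> k + j < a \<or> a + 1 \<le> k + j \<and> j < b"
      using x by auto
    from j show ?thesis
    proof
      assume j: "b \<le> j \<and> j < n \<and> k + j < a"
      \<comment> \<open>The last bottom cell of the subpartition carries its largest bottom
        label.\<close>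
      then have "\<theta> (1, j) < \<theta> (0, a - 1)" using gt[of j "a - 1"] ab by auto
      moreover have "(0, a - 1) \<in> cells ?mu" "(1, j) \<in> cells ?lam - cells ?mu"
        using j by (auto simp: mem_cells_two_partition)
      moreover have "x = (min 0 1, min (a - 1) j)" using xj j by auto
      ultimately show ?thesis unfolding deficit_cells_def by blast
    next
      assume j: "a + 1 \<le> k + j \<and> j < b"
      \<comment> \<open>Since \<open>j < n\<close>, the bound \<open>k + n \<le> m + 1\<close>
        leaves a bottom cell outside the subpartition; the first such cell is the witness.\<close>
      then have am: "a < m" using k ab by linarith
      then have "\<theta> (0, a) < \<theta> (1, j)" using lt[of j a] ab j by auto
      moreover have "(1, j) \<in> cells ?mu" "(0, a) \<in> cells ?lam - cells ?mu"
        using j am by (auto simp: mem_cells_two_partition)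
      moreover have "x = (min 1 0, min j a)" using xj j ab by auto
      ultimately show ?thesis unfolding deficit_cells_def by blast
    qed
  qed
  ultimately show ?thesis by blast
qed

lemma sim_row_regular:
  assumes "i_row_regular m n i \<theta>" "1 \<le> i" "k = n + i - 1" "k + n \<le> m + 1"
    and ab: "b \<le> a" "a \<le> m" "b \<le> n"
  shows "sim (two_partition m n) \<theta> (two_partition a b) = a + b - deficit n k a b"
proof -
  let ?J = "{b..<min n (a - k)} \<union> {a + 1 - k..<b}"
  have "card ?J = deficit n k a b"
    unfolding deficit_def by (subst card_Un_disjoint) auto
  then have "card (Pair (0::nat) ` ?J) = deficit n k a b"
    by (simp add: card_image inj_on_def)
  moreover have "Pair 0 ` ?J \<subseteq> cells (two_partition a b)"
    using ab by (auto simp: mem_cells_two_partition)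
  ultimately show ?thesis
    unfolding sim_def deficit_cells_row_regular[OF assms]
    by (simp add: card_Diff_subset card_cells_two_partition)
qed

section \<open>Inverting the deficit count for a fixed size\<close>

text \<open>The length of the upper row of the subpartition of size \<open>s\<close> with \<open>d\<close> deficit cells.\<close>

definition upper_row :: "nat \<Rightarrow> nat \<Rightarrow> nat \<Rightarrow> nat \<Rightarrow> nat" where
  "upper_row n k s d =
     (if s - k < d then d
      else if 2 * n \<le> d + (s - k) then n - d
      else if even (s - k - d) then (s - k - d) div 2
      else (s - k + d + 1) div 2)"

text \<open>Each branch of \<open>upper_row\<close> solves one of the four expressions for the
  deficit count for \<open>b\<close>; here the branches become linear relations free of
  \<open>div\<close>.\<close>

lemma upper_row_cases:
  obtains "s - k < d" "upper_row n k s d = d"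
  | "d \<le> s - k" "2 * n \<le> d + (s - k)" "upper_row n k s d = n - d"
  | "d + (s - k) < 2 * n" "s - k = d + 2 * upper_row n k s d"
  | "k + d \<le> s" "d + s < k + 2 * n" "d + s + 1 = k + 2 * upper_row n k s d"
proof -
  consider "s - k < d" | "d \<le> s - k" "2 * n \<le> d + (s - k)"
    | e where "d + (s - k) < 2 * n" "s - k = d + 2 * e"
    | e where "d + (s - k) < 2 * n" "s - k = d + 2 * e + 1"
    by (metis (no_types) add.assoc evenE le_add_diff_inverse not_less oddE)
  then show thesis
  proof cases
    case 1
    then have "upper_row n k s d = d" by (simp add: upper_row_def)
    with 1 show thesis by (rule that(1))
  next
    case 2
    then have "upper_row n k s d = n - d" by (simp add: upper_row_def)
    with 2 show thesis by (rule that(2))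
  next
    case (3 e)
    then have "upper_row n k s d = e" by (simp add: upper_row_def)
    with 3 show thesis by (intro that(3)) simp_all
  next
    case (4 e)
    then have "upper_row n k s d = d + e + 1" by (simp add: upper_row_def)
    with 4 show thesis by (intro that(4)) linarith+
  qed
qed

text \<open>At most one range counted by \<open>deficit\<close> is nonempty: the first needs
  \<open>k + b < a\<close>, the second \<open>a + 1 < k + b\<close>. The outer cases are those where
  the first range stops at column \<open>n\<close> or the second starts at column 0.\<close>

lemma deficit_cases:
  assumes "b \<le> n"
  obtains "k + n \<le> a" "deficit n k a b + b = n"
  | "a < k + n" "a = k + b + deficit n k a b"
  | "k \<le> a" "a + 1 + deficit n k a b = k + b"
  | "a < k" "deficit n k a b = b"
proof -
  consider "k + n \<le> a" | "a < k + n" "k + b \<le> a" | "k \<le> a" "a < k + n" "a < k + b" | "a < k"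
    by linarith
  then show thesis
  proof cases
    case 1
    then have "deficit n k a b + b = n" using assms unfolding deficit_def by linarith
    with 1 show thesis by (rule that(1))
  next
    case 2
    then have "a = k + b + deficit n k a b" unfolding deficit_def by linarith
    with 2(1) show thesis by (rule that(2))
  next
    case 3
    then have "a + 1 + deficit n k a b = k + b" unfolding deficit_def by linarith
    with 3(1) show thesis by (rule that(3))
  next
    case 4
    then have "deficit n k a b = b" unfolding deficit_def by linarith
    with 4 show thesis by (rule that(4))
  qed
qed

text \<open>With \<open>s = a + b\<close>, the last two bounds
  \<open>2 * d \<le> s \<le> m + n - d\<close> correspond to the range of exponents in the Schur
  polynomial.\<close>

lemma deficit_bounds:
  assumes "n \<le> k" "k + n \<le> m + 1" "b \<le> a" "a \<le> m" "b \<le> n"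
  shows "deficit n k a b \<le> min n (m - n)"
    and "2 * deficit n k a b \<le> a + b"
    and "a + b + deficit n k a b \<le> m + n"
proof -
  have "deficit n k a b \<le> n \<and> n + deficit n k a b \<le> m \<and> 2 * deficit n k a b \<le> a + b
      \<and> a + b + deficit n k a b \<le> m + n"
    by (cases rule: deficit_cases[OF assms(5), of k a]; intro conjI; use assms in linarith)
  then show "deficit n k a b \<le> min n (m - n)" "2 * deficit n k a b \<le> a + b"
    "a + b + deficit n k a b \<le> m + n" by auto
qed

text \<open>Injectivity: size and deficit count determine the upper row, hence both rows.\<close>

lemma upper_row_deficit:
  assumes "b \<le> n"
  shows "upper_row n k (a + b) (deficit n k a b) = b"
proof (cases rule: deficit_cases[OF assms, of k a])
  case 1
  then have "\<not> a + b - k < deficit n k a b" "2 * n \<le> deficit n k a b + (a + b - k)"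
    by linarith+
  with 1(2) show ?thesis unfolding upper_row_def by simp
next
  case 2
  then have "a + b - k = 2 * b + deficit n k a b" "b + deficit n k a b < n" by linarith+
  then show ?thesis unfolding upper_row_def by simp
next
  case 3
  then have "deficit n k a b < b" by linarith
  \<comment> \<open>The excess of \<open>a + b - k\<close> over the deficit is the odd number
    \<open>2 * e + 1\<close>, which selects the last branch of \<open>upper_row\<close>.\<close>
  then obtain e where e: "b = deficit n k a b + e + 1"
    using less_imp_Suc_add by fastforce
  with 3 have u: "a + b - k = deficit n k a b + 2 * e + 1" by linarith
  have "\<not> 2 * n \<le> deficit n k a b + (a + b - k)" using u e assms by linarith
  with u show ?thesis unfolding upper_row_def using e by simp
next
  case 4
  \<comment> \<open>If \<open>b = 0\<close>, the first branch is not taken, but the branch reached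
    still returns 0.\<close>
  then have "a + b - k < b \<or> b = 0 \<and> a + b - k = 0" by linarith
  with 4(2) show ?thesis unfolding upper_row_def by auto
qed

text \<open>For \<open>b = upper_row n k s d\<close> and \<open>a = s - b\<close> these say
  \<open>b \<le> n\<close>, \<open>b \<le> a\<close> and \<open>a \<le> m\<close>.\<close>

lemma upper_row_bounds:
  assumes "n \<le> k" "k + n \<le> m + 1" "d \<le> min n (m - n)" "2 * d \<le> s" "s + d \<le> m + n"
  shows "upper_row n k s d \<le> n"
    and "2 * upper_row n k s d \<le> s"
    and "s \<le> m + upper_row n k s d"
proof -
  have d: "d \<le> n" "d + n \<le> m" using assms(1-3) by linarith+
  have "upper_row n k s d \<le> n \<and> 2 * upper_row n k s d \<le> s \<and> s \<le> m + upper_row n k s d"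
    by (cases rule: upper_row_cases[of s k d n]; intro conjI; use assms(1,2,4,5) d in linarith)
  then show "upper_row n k s d \<le> n" "2 * upper_row n k s d \<le> s" "s \<le> m + upper_row n k s d"
    by auto
qed

text \<open>Surjectivity, once \<open>upper_row_bounds\<close> ensures that the pair is a
  subpartition.\<close>

lemma deficit_upper_row:
  assumes "n \<le> k" "d \<le> n" "2 * d \<le> s"
  shows "deficit n k (s - upper_row n k s d) (upper_row n k s d) = d"
proof (cases rule: upper_row_cases[of s k d n])
  case 1
  then have "s - d < k" using assms(3) by linarith
  then show ?thesis unfolding deficit_def 1(2) by linarith
next
  case 2
  define a where "a = s - (n - d)"
  have "n \<le> a - k" using 2 assms unfolding a_def by linarith
  then show ?thesis unfolding deficit_def 2(3) a_def[symmetric] using assms(2) by simp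
next
  case 3
  define e where "e = upper_row n k s d"
  have "s - e - k = d + e" "s - e + 1 - k \<ge> e" "d + e < n" using 3 unfolding e_def by linarith+
  then show ?thesis unfolding deficit_def e_def[symmetric] by simp
next
  case 4
  define e where "e = upper_row n k s d"
  have e: "d < e" "e \<le> n" "s - e + 1 - k = e - d" "s - e - k < e"
    using 4 unfolding e_def by linarith+
  then show ?thesis unfolding deficit_def e_def[symmetric] by simp
qed

section \<open>Matching the two sums term by term\<close>

theorem theorem4p10:
  fixes m n :: nat and \<theta> :: "nat \<times> nat \<Rightarrow> nat"
  assumes "n \<le> m"
    and "triangular (two_partition m n)"
    and "row_regular m n \<theta>"
  shows "A_poly (two_partition m n) \<theta> = (\<Sum>d=0..min n (m - n). schur2 (m + n - 2 * d) d)"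
proof -
  let ?lam = "two_partition m n"
  let ?P = "{(a, b). b \<le> a \<and> a \<le> m \<and> b \<le> n}"
  \<comment> \<open>\<open>A\<close> is the exponent of \<open>q\<close>, hence the area; the
    subpartition has size \<open>m + n - A\<close>.\<close>
  let ?T = "SIGMA d : {0..min n (m - n)}. {d..m + n - 2 * d}"
  obtain i where i: "1 \<le> i" "int i \<le> int m - 2 * (int n - 1)" and reg: "i_row_regular m n i \<theta>"
    using assms(3) unfolding row_regular_def by blast
  define k where "k = n + i - 1"
  have "i + 2 * n \<le> m + 2" using i(2) by presburger
  with i(1) have k: "n \<le> k" "k + n \<le> m + 1" unfolding k_def by linarith+
  let ?D = "deficit n k"
  let ?B = "\<lambda>d A. upper_row n k (m + n - A) d"
  have "A_poly ?lam \<theta> =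
      (\<Sum>(a, b)\<in>?P. q_var ^ area ?lam (two_partition a b) * t_var ^ sim ?lam \<theta> (two_partition a b))"
    unfolding A_poly_def subpartitions_two_partition
    by (subst sum.reindex[OF inj_on_subset[OF inj_two_partition subset_UNIV]])
       (simp add: case_prod_unfold)
  also have "\<dots> = (\<Sum>(a, b)\<in>?P. q_var ^ (m + n - (a + b)) * t_var ^ (a + b - ?D a b))"
    by (rule sum.cong)
       (auto simp: area_def card_cells_two_partition sim_row_regular[OF reg i(1) k_def k(2)])
  also have "\<dots> = (\<Sum>(d, A)\<in>?T. q_var ^ A * t_var ^ (d + (m + n - 2 * d) - A))"
  proof (rule sum.reindex_bij_witness
      [where i = "\<lambda>(d, A). (m + n - A - ?B d A, ?B d A)"
         and j = "\<lambda>(a, b). (?D a b, m + n - (a + b))"], goal_cases)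
    case (1 x)
    then show ?case
      using upper_row_deficit by auto
  next
    case (2 x)
    then obtain a b where x: "x = (a, b)" "b \<le> a" "a \<le> m" "b \<le> n" by auto
    then show ?case
      using deficit_bounds[OF k x(2-4)] by auto
  next
    case (3 x)
    then obtain d A where x: "x = (d, A)" "d \<le> min n (m - n)" "d \<le> A" "A \<le> m + n - 2 * d" by auto
    \<comment> \<open>The two ends of the range of \<open>A\<close> become the two bounds on the
      size.\<close>
    then have s: "2 * d \<le> m + n - A" "m + n - A + d \<le> m + n" and A: "A \<le> m + n" "d \<le> n"
      using x(2-4) assms(1) by auto
    show ?case
      using deficit_upper_row[OF k(1) A(2) s(1)] upper_row_bounds[OF k x(2) s] x(1) A by auto
  next
    case (4 x)
    then obtain d A where x: "x = (d, A)" "d \<le> min n (m - n)" "d \<le> A" "A \<le> m + n - 2 * d" by auto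
    then have s: "2 * d \<le> m + n - A" "m + n - A + d \<le> m + n"
      using assms(1) by auto
    show ?case
      using upper_row_bounds[OF k x(2) s] x(1) by auto
  next
    case (5 x)
    then obtain a b where x: "x = (a, b)" "b \<le> a" "a \<le> m" "b \<le> n" by auto
    have "?D a b + (m + n - 2 * ?D a b) - (m + n - (a + b)) = a + b - ?D a b"
      using deficit_bounds[OF k x(2-4)] x(2-4) by linarith
    then show ?case using x(1) by simp
  qed
  also have "\<dots> = (\<Sum>d=0..min n (m - n). schur2 (m + n - 2 * d) d)"
    unfolding schur2_def by (subst sum.Sigma) auto
  finally show ?thesis .
qed

end
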